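(* There exists an uncountable family $\mathcal{F}\subseteq\mathcal{LC}$ of sequences such that: (1) the sequences $M\in\mathcal{F}$ are pairwise non-equivalent (as sequences), and the associated weight functions $\omega_M$, $M\in\mathcal{F}$, are pairwise non-equivalent (as functions); (2) for each $M\in\mathcal{F}$ the function $\omega_M$ is a normalized and non-quasianalytic BMT-weight function; (3) for each $M\in\mathcal{F}$ there does not exist a weight function $\tau$ such that $\tau$ is equivalent to $\omega_M$ and $\tau$ is almost subadditive.
   Context: Here $\mathbb{N}=\{0,1,2,\dots\}$. A weight function is a function $\omega:[0,+\infty)\to[0,+\infty)$ which is non-decreasing and satisfies $\lim_{t\to+\infty}\omega(t)=+\infty$. Two functions $\sigma,\tau:[0,+\infty)\to[0,+\infty)$ are equivalent if $\sigma(t)=O(\tau(t))$ and $\tau(t)=O(\sigma(t))$ as $t\to+\infty$. A weight function $\omega$ is almost subadditive if for every $q>1$ there exists $C_q\ge 1$ such that for all $s,t\ge 0$: $\omega(s+t)\le q(\omega(s)+\omega(t))+C_q$. A BMT-weight function is a function $\omega:[0,+\infty)\to[0,+\infty)$ which is continuous, non-decreasing, with $\omega(0)=0$, and such that $\omega(2t)=O(\omega(t))$ as $t\to+\infty$, $\log(t)=o(\omega(t))$ as $t\to+\infty$, and $t\mapsto\omega(e^t)$ is convex on $\mathbb{R}$. It is normalized if $\omega(t)=0$ for all $0\le t\le 1$, and non-quasianalytic if $\int_1^{\infty}\frac{\omega(t)}{t^2}\,dt<+\infty$. $\mathcal{LC}$ is the set of all sequences $M=(M_j)_{j\in\mathbb{N}}$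 of positive real numbers such that $1=M_0\le M_1$, $M_j^2\le M_{j-1}M_{j+1}$ for all $j\ge 1$, and $\lim_{j\to+\infty}(M_j)^{1/j}=+\infty$. Two sequences $M,N$ of positive real numbers are equivalent if $0<\inf_{j\ge 1}\left(\frac{M_j}{N_j}\right)^{1/j}\le\sup_{j\ge 1}\left(\frac{M_j}{N_j}\right)^{1/j}<+\infty$. For $M\in\mathcal{LC}$ the associated weight function $\omega_M:[0,+\infty)\to[0,+\infty)$ is $\omega_M(t):=\sup_{j\in\mathbb{N}}\log\left(\frac{t^j}{M_j}\right)$ for $t>0$, and $\omega_M(0):=0$. *)

theory Defs
  imports "HOL-Analysis.Analysis" "HOL-Library.Landau_Symbols"
begin

text \<open>
  A function from the half-line \<open>[0, \<infinity>)\<close> to itself is represented by a total function of type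
  \<^typ>\<open>real \<Rightarrow> real\<close>; no definition below depends on its values at negative arguments.
\<close>

definition weight_function :: "(real \<Rightarrow> real) \<Rightarrow> bool" where
  "weight_function \<omega> \<longleftrightarrow>
     (\<forall>t\<ge>0. 0 \<le> \<omega> t) \<and> mono_on {0..} \<omega> \<and> filterlim \<omega> at_top at_top"

definition equivalent_functions :: "(real \<Rightarrow> real) \<Rightarrow> (real \<Rightarrow> real) \<Rightarrow> bool" where
  "equivalent_functions \<sigma> \<tau> \<longleftrightarrow> \<sigma> \<in> O[at_top](\<tau>) \<and> \<tau> \<in> O[at_top](\<sigma>)"

definition almost_subadditive :: "(real \<Rightarrow> real) \<Rightarrow> bool" where
  "almost_subadditive \<omega> \<longleftrightarrow>
     (\<forall>q>1. \<exists>C\<ge>1. \<forall>s\<ge>0. \<forall>t\<ge>0. \<omega> (s + t) \<le> q * (\<omega> s + \<omega> t) + C)"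

definition BMT_weight_function :: "(real \<Rightarrow> real) \<Rightarrow> bool" where
  "BMT_weight_function \<omega> \<longleftrightarrow>
     (\<forall>t\<ge>0. 0 \<le> \<omega> t) \<and> continuous_on {0..} \<omega> \<and> mono_on {0..} \<omega> \<and> \<omega> 0 = 0 \<and>
     (\<lambda>t. \<omega> (2 * t)) \<in> O[at_top](\<omega>) \<and>
     ln \<in> o[at_top](\<omega>) \<and>
     convex_on UNIV (\<lambda>t. \<omega> (exp t))"

definition normalized_weight :: "(real \<Rightarrow> real) \<Rightarrow> bool" where
  "normalized_weight \<omega> \<longleftrightarrow> (\<forall>t. 0 \<le> t \<and> t \<le> 1 \<longrightarrow> \<omega> t = 0)"

definition non_quasianalytic :: "(real \<Rightarrow> real) \<Rightarrow> bool" where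
  "non_quasianalytic \<omega> \<longleftrightarrow> set_integrable lborel {1..} (\<lambda>t. \<omega> t / t\<^sup>2)"

definition LC :: "(nat \<Rightarrow> real) set" where
  "LC = {M. (\<forall>j. 0 < M j) \<and> M 0 = 1 \<and> 1 \<le> M 1 \<and>
            (\<forall>j\<ge>1. (M j)\<^sup>2 \<le> M (j - 1) * M (j + 1)) \<and>
            filterlim (\<lambda>j. root j (M j)) at_top sequentially}"

text \<open>The infimum and supremum are taken in the extended reals, so neither needs a boundedness
  side condition.\<close>

definition equivalent_sequences :: "(nat \<Rightarrow> real) \<Rightarrow> (nat \<Rightarrow> real) \<Rightarrow> bool" where
  "equivalent_sequences M N \<longleftrightarrow>
     0 < (INF j\<in>{1..}. ereal (root j (M j / N j))) \<and>
     (SUP j\<in>{1..}. ereal (root j (M j / N j))) < \<infinity>"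

text \<open>For \<open>M \<in> LC\<close> and \<open>t > 0\<close> the set of which the supremum is taken is bounded above, because
  the \<open>j\<close>-th roots of \<open>M j\<close> tend to infinity, so the real-valued supremum is the intended one.\<close>

definition assoc_weight :: "(nat \<Rightarrow> real) \<Rightarrow> real \<Rightarrow> real" where
  "assoc_weight M t = (if t > 0 then (SUP j. ln (t ^ j / M j)) else 0)"

end

theory Submission
  imports Defs "HOL-Library.Discrete_Functions"
begin

text \<open>
  Up to bounded factors, \<open>\<omega>\<^sub>M (e\<^sup>x)\<close> is the supremum over \<open>i\<close> of \<open>2\<^sup>i (x - s r\<^sub>i)\<close>, where
  \<open>s r\<^sub>i = log (M\<^sub>j) / j\<close> at \<open>j = 2\<^sup>i\<close>. We take \<open>r\<^sub>i\<close> with steps in \<open>[1, 2]\<close>, so that \<open>M\<close> is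
  log-convex and \<open>\<omega>\<^sub>M\<close> is doubling. While \<open>x\<close> grows by one step \<open>s (r\<^bsub>i+1\<^esub> - r\<^sub>i)\<close>, the weight
  essentially doubles; it thus grows slower than a power \<open>t\<^sup>\<gamma>\<close> with \<open>\<gamma> < 1\<close> as soon as the mean
  step exceeds \<open>ln 2\<close>, and faster than \<open>t\<close> on stretches where all steps are smaller than
  \<open>ln 2\<close>. Arbitrarily long stretches of the second kind exclude almost subadditivity, since a
  function equivalent to an almost subadditive one satisfies \<open>\<omega> (2\<^sup>k t) \<le> D 2\<^sup>k \<omega> t\<close> for \<open>t\<close> large
  depending on \<open>k\<close>, with \<open>D\<close> independent of \<open>k\<close>. With mean step of \<open>r\<close> at least \<open>3/2\<close> and long
  runs of steps \<open>1\<close>, every \<open>s\<close> in \<open>[1/2, 3/5]\<close> works. Since \<open>\<omega>\<close> for the parameter \<open>s\<close> is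
  \<open>s \<psi> (t\<^bsup>1/s\<^esup>)\<close> with \<open>\<psi>\<close> growing at least like a power, different \<open>s\<close> give non-equivalent weights.
\<close>

section \<open>Associated weight functions\<close>

lemma LC_pos: "M \<in> LC \<Longrightarrow> 0 < M j"
  by (simp add: LC_def)

text \<open>Log-convexity carries \<open>M 0 \<le> M 1\<close> on to every later pair, after
  cancelling the positive factor \<open>M (Suc j)\<close>.\<close>

lemma LC_mono_Suc:
  assumes "M \<in> LC"
  shows "M j \<le> M (Suc j)"
proof (induction j)
  case 0
  then show ?case using assms by (simp add: LC_def)
next
  case (Suc j)
  have "(M (Suc j))\<^sup>2 \<le> M j * M (Suc (Suc j))"
    using assms by (auto simp: LC_def dest!: spec[where x = "Suc j"])
  also have "\<dots> \<le> M (Suc j) * M (Suc (Suc j))"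
    using Suc LC_pos[OF assms] by (intro mult_right_mono) (auto intro: less_imp_le)
  finally show ?case
    using LC_pos[OF assms, of "Suc j"] by (simp add: power2_eq_square)
qed

lemma LC_ge_1:
  assumes "M \<in> LC"
  shows "1 \<le> M j"
  using assms lift_Suc_mono_le[of M 0 j, OF LC_mono_Suc] by (simp add: LC_def)

text \<open>In the variable \<open>x = ln t\<close> the weight is a supremum of affine functions,
  the convex conjugate of \<open>ln (M j)\<close>; later bounds are proved term by term.\<close>

lemma assoc_weight_exp:
  assumes "M \<in> LC"
  shows "assoc_weight M (exp x) = (SUP j. real j * x - ln (M j))"
proof -
  have "ln (exp x ^ j / M j) = real j * x - ln (M j)" for j
    using LC_pos[OF assms, of j] by (simp add: ln_div ln_realpow)
  then show ?thesis by (simp add: assoc_weight_def)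
qed

text \<open>Once \<open>root j (M j)\<close> exceeds \<open>exp x\<close> the terms are at most 0,
  so only finitely many can be positive.\<close>

lemma LC_bdd_above:
  assumes "M \<in> LC"
  shows "bdd_above (range (\<lambda>j. real j * x - ln (M j)))"
proof -
  have "filterlim (\<lambda>j. root j (M j)) at_top sequentially"
    using assms by (simp add: LC_def)
  then have "eventually (\<lambda>j. exp x \<le> root j (M j)) sequentially"
    by (simp add: filterlim_at_top)
  then have "eventually (\<lambda>j. real j * x - ln (M j) \<le> 0) sequentially"
    using eventually_gt_at_top[of 0]
  proof eventually_elim
    case (elim j)
    have "exp x ^ j \<le> M j"
      using elim LC_pos[OF assms, of j] power_mono[OF elim(1), of j] by simp
    then have "exp (real j * x) \<le> M j" by (simp add: exp_of_nat_mult)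
    then have "real j * x \<le> ln (M j)"
      using LC_pos[OF assms, of j] by (simp add: ln_ge_iff)
    then show ?case by simp
  qed
  then have "\<exists>k. \<forall>j\<ge>k. real j * x - ln (M j) \<le> 0"
    by (simp add: eventually_sequentially)
  then obtain k where k: "\<And>j. j \<ge> k \<Longrightarrow> real j * x - ln (M j) \<le> 0"
    by blast
  have "range (\<lambda>j. real j * x - ln (M j)) \<subseteq> (\<lambda>j. real j * x - ln (M j)) ` {..<k} \<union> {..0}"
  proof
    fix y assume "y \<in> range (\<lambda>j. real j * x - ln (M j))"
    then obtain j where j: "y = real j * x - ln (M j)" by blast
    show "y \<in> (\<lambda>j. real j * x - ln (M j)) ` {..<k} \<union> {..0}"
      using k[of j] by (cases "j < k") (auto simp: j)
  qed
  moreover have "bdd_above ((\<lambda>j. real j * x - ln (M j)) ` {..<k} \<union> {..0})"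
    by (simp add: bdd_above_finite)
  ultimately show ?thesis by (rule bdd_above_mono[rotated])
qed

lemma assoc_weight_exp_ge:
  assumes "M \<in> LC"
  shows "real j * x - ln (M j) \<le> assoc_weight M (exp x)"
  unfolding assoc_weight_exp[OF assms]
  by (rule cSUP_upper[OF _ LC_bdd_above[OF assms]]) simp

lemma assoc_weight_exp_le:
  assumes "M \<in> LC" "\<And>j. real j * x - ln (M j) \<le> C"
  shows "assoc_weight M (exp x) \<le> C"
  unfolding assoc_weight_exp[OF assms(1)]
  by (rule cSUP_least) (use assms in auto)

lemma assoc_weight_nonneg:
  assumes "M \<in> LC"
  shows "0 \<le> assoc_weight M t"
proof (cases "t > 0")
  case True
  have "M 0 = 1" using assms by (simp add: LC_def)
  then show ?thesis using assoc_weight_exp_ge[OF assms, of 0 "ln t"] True by simp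
qed (simp add: assoc_weight_def)

lemma assoc_weight_normalized:
  assumes "M \<in> LC"
  shows "normalized_weight (assoc_weight M)"
  unfolding normalized_weight_def
proof (intro allI impI)
  fix t :: real assume t: "0 \<le> t \<and> t \<le> 1"
  show "assoc_weight M t = 0"
  proof (cases "t = 0")
    case False
    then have t: "0 < t" "t \<le> 1" using t by auto
    have "real j * ln t - ln (M j) \<le> 0" for j
    proof -
      have "0 \<le> ln (M j)" using LC_ge_1[OF assms, of j] by simp
      moreover have "real j * ln t \<le> 0" using t by (simp add: mult_le_0_iff)
      ultimately show ?thesis by linarith
    qed
    then have "assoc_weight M (exp (ln t)) \<le> 0"
      by (intro assoc_weight_exp_le[OF assms])
    then show ?thesis using assoc_weight_nonneg[OF assms, of t] t by simp
  qed (simp add: assoc_weight_def)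
qed

lemma assoc_weight_mono:
  assumes "M \<in> LC"
  shows "mono_on {0..} (assoc_weight M)"
proof (rule mono_onI)
  fix u v :: real assume uv: "u \<in> {0..}" "v \<in> {0..}" "u \<le> v"
  show "assoc_weight M u \<le> assoc_weight M v"
  proof (cases "u = 0")
    case True
    then show ?thesis using assoc_weight_nonneg[OF assms, of v] by (simp add: assoc_weight_def)
  next
    case False
    then have pos: "0 < u" "0 < v" using uv by auto
    have "assoc_weight M (exp (ln u)) \<le> assoc_weight M (exp (ln v))"
    proof (rule assoc_weight_exp_le[OF assms])
      fix j
      have "real j * ln u \<le> real j * ln v"
        using pos uv by (intro mult_left_mono) auto
      then show "real j * ln u - ln (M j) \<le> assoc_weight M (exp (ln v))"
        using assoc_weight_exp_ge[OF assms, of j "ln v"] by linarith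
    qed
    then show ?thesis using pos by simp
  qed
qed

lemma assoc_weight_convex:
  assumes "M \<in> LC"
  shows "convex_on UNIV (\<lambda>x. assoc_weight M (exp x))"
proof
  fix u x y :: real assume u: "0 < u" "u < 1"
  show "assoc_weight M (exp ((1 - u) *\<^sub>R x + u *\<^sub>R y))
      \<le> (1 - u) * assoc_weight M (exp x) + u * assoc_weight M (exp y)"
  proof (rule assoc_weight_exp_le[OF assms])
    fix j
    have "real j * ((1 - u) *\<^sub>R x + u *\<^sub>R y) - ln (M j)
        = (1 - u) * (real j * x - ln (M j)) + u * (real j * y - ln (M j))"
      by (simp add: algebra_simps)
    also have "\<dots> \<le> (1 - u) * assoc_weight M (exp x) + u * assoc_weight M (exp y)"
      using u by (intro add_mono mult_left_mono assoc_weight_exp_ge[OF assms]) auto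
    finally show "real j * ((1 - u) *\<^sub>R x + u *\<^sub>R y) - ln (M j)
        \<le> (1 - u) * assoc_weight M (exp x) + u * assoc_weight M (exp y)" .
  qed
qed simp

text \<open>Convexity in \<open>ln t\<close> yields continuity only for \<open>t > 0\<close>; near 0
  the vanishing on \<open>{0..1}\<close> takes over.\<close>

lemma assoc_weight_continuous:
  assumes "M \<in> LC"
  shows "continuous_on {0..} (assoc_weight M)"
proof -
  have "continuous_on {0..1} (assoc_weight M) \<longleftrightarrow> continuous_on {0..1} (\<lambda>_::real. 0::real)"
    using assoc_weight_normalized[OF assms]
    by (intro continuous_on_cong) (auto simp: normalized_weight_def)
  then have c0: "continuous_on {0..1} (assoc_weight M)" by simp
  have "continuous_on UNIV (\<lambda>x. assoc_weight M (exp x))"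
    using convex_on_continuous[OF open_UNIV assoc_weight_convex[OF assms]] .
  moreover have "continuous_on {1..} (ln :: real \<Rightarrow> real)"
    by (intro continuous_intros) auto
  ultimately have "continuous_on {1..} (\<lambda>t. assoc_weight M (exp (ln t)))"
    using continuous_on_compose2[of UNIV "\<lambda>x. assoc_weight M (exp x)" "{1..}" ln] by auto
  moreover have "continuous_on {1..} (\<lambda>t. assoc_weight M (exp (ln t)))
      \<longleftrightarrow> continuous_on {1..} (assoc_weight M)"
    by (intro continuous_on_cong) auto
  ultimately have "continuous_on {1..} (assoc_weight M)" by blast
  then have "continuous_on ({0..1} \<union> {1..}) (assoc_weight M)"
    using c0 by (intro continuous_on_closed_Un) auto
  moreover have "{0..1} \<union> {1..} = {0::real..}" by auto
  ultimately show ?thesis by simp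
qed

lemma ln_smallo_assoc_weight:
  assumes "M \<in> LC"
  shows "ln \<in> o[at_top](assoc_weight M)"
proof (rule landau_o.smallI)
  fix c :: real assume c: "c > 0"
  \<comment> \<open>One index suffices: half of the coefficient \<open>2 / c\<close> pays for the
    constant \<open>ln (M j)\<close>, the other half remains.\<close>
  obtain j where j: "2 / c < real j" using reals_Archimedean2 by blast
  have "eventually (\<lambda>t. ln (M j) \<le> 1 / c * ln t) at_top"
    using c by real_asymp
  then show "eventually (\<lambda>t. norm (ln t) \<le> c * norm (assoc_weight M t)) at_top"
    using eventually_ge_at_top[of 1]
  proof eventually_elim
    case (elim t)
    have "2 / c * ln t \<le> real j * ln t"
      using j elim by (intro mult_right_mono) auto
    moreover have "2 / c * ln t - 1 / c * ln t = 1 / c * ln t"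
      by (simp add: field_simps)
    ultimately have "1 / c * ln t \<le> real j * ln t - ln (M j)"
      using elim by linarith
    also have "\<dots> \<le> assoc_weight M t"
      using assoc_weight_exp_ge[OF assms, of j "ln t"] elim by simp
    finally have "ln t \<le> c * assoc_weight M t"
      using c by (simp add: field_simps)
    then show ?case using elim assoc_weight_nonneg[OF assms, of t] by simp
  qed
qed

lemma assoc_weight_at_top:
  assumes "M \<in> LC"
  shows "filterlim (assoc_weight M) at_top at_top"
proof -
  have "eventually (\<lambda>t. norm (ln t) \<le> 1 * norm (assoc_weight M t)) at_top"
    using landau_o.smallD[OF ln_smallo_assoc_weight[OF assms], of 1] by simp
  then have "eventually (\<lambda>t. ln t \<le> assoc_weight M t) at_top"
    by (rule eventually_mono) (use assoc_weight_nonneg[OF assms] in auto)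
  then show ?thesis
    by (rule filterlim_at_top_mono[OF ln_at_top])
qed

section \<open>Growth of almost subadditive functions\<close>

text \<open>Each doubling applies the defining inequality with equal arguments. \<open>C\<close> may
  depend on \<open>k\<close> and \<open>q\<close>, but not on \<open>t\<close>.\<close>

lemma almost_subadditive_dyadic:
  assumes "almost_subadditive \<tau>" "q > 1"
  shows "\<exists>C. \<forall>t\<ge>0. \<tau> (2 ^ k * t) \<le> (2 * q) ^ k * \<tau> t + C"
proof (induction k)
  case 0
  then show ?case by (auto intro: exI[of _ 0])
next
  case (Suc k)
  then obtain C where C: "\<And>t. t \<ge> 0 \<Longrightarrow> \<tau> (2 ^ k * t) \<le> (2 * q) ^ k * \<tau> t + C" by blast
  obtain C' where C': "\<And>s t. s \<ge> 0 \<Longrightarrow> t \<ge> 0 \<Longrightarrow> \<tau> (s + t) \<le> q * (\<tau> s + \<tau> t) + C'"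
    using assms unfolding almost_subadditive_def by blast
  have "\<tau> (2 ^ Suc k * t) \<le> (2 * q) ^ Suc k * \<tau> t + (2 * q * C + C')" if "t \<ge> 0" for t
  proof -
    have "\<tau> (2 ^ Suc k * t) \<le> 2 * q * \<tau> (2 ^ k * t) + C'"
      using C'[of "2 ^ k * t" "2 ^ k * t"] that by (simp add: mult_ac flip: mult_2)
    also have "\<dots> \<le> 2 * q * ((2 * q) ^ k * \<tau> t + C) + C'"
      using C[OF that] assms by (intro add_right_mono mult_left_mono) auto
    finally show ?thesis by (simp add: algebra_simps)
  qed
  then show ?case by blast
qed

text \<open>Taking \<open>q\<close> with \<open>q ^ k \<le> 2\<close> makes the constant independent of \<open>k\<close>; this independence
  survives the passage to an equivalent function.\<close>

lemma equivalent_almost_subadditive_dyadic: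
  assumes \<tau>: "weight_function \<tau>" "almost_subadditive \<tau>" and "equivalent_functions \<tau> \<omega>"
  shows "\<exists>D. \<forall>k. eventually (\<lambda>t. \<omega> (2 ^ k * t) \<le> D * 2 ^ k * \<bar>\<omega> t\<bar>) at_top"
proof -
  have "\<tau> \<in> O[at_top](\<omega>)" "\<omega> \<in> O[at_top](\<tau>)"
    using assms by (auto simp: equivalent_functions_def)
  then obtain A B where A: "A > 0" "eventually (\<lambda>t. norm (\<tau> t) \<le> A * norm (\<omega> t)) at_top"
    and B: "B > 0" "eventually (\<lambda>t. norm (\<omega> t) \<le> B * norm (\<tau> t)) at_top"
    by (metis landau_o.bigE)
  have "eventually (\<lambda>t. \<omega> (2 ^ k * t) \<le> (3 * A * B) * 2 ^ k * \<bar>\<omega> t\<bar>) at_top" for k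
  proof -
    \<comment> \<open>The root of order \<open>Suc k\<close> also covers \<open>k = 0\<close>, where
      \<open>q > 1\<close> is still needed.\<close>
    define q :: real where "q = 2 powr (1 / real (Suc k))"
    have q: "q > 1" "q ^ Suc k = 2"
      unfolding q_def by (simp, simp add: powr_power del: power_Suc of_nat_Suc)
    then have "q ^ k \<le> 2"
      by (metis less_imp_le lessI power_increasing)
    obtain C where C: "\<And>t. t \<ge> 0 \<Longrightarrow> \<tau> (2 ^ k * t) \<le> (2 * q) ^ k * \<tau> t + C"
      using almost_subadditive_dyadic[OF \<tau>(2) q(1), of k] by blast
    have "filterlim \<tau> at_top at_top" using \<tau>(1) by (simp add: weight_function_def)
    then have evC: "eventually (\<lambda>t. C \<le> \<tau> t) at_top" by (simp add: filterlim_at_top)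
    have "filterlim (\<lambda>t::real. 2 ^ k * t) at_top at_top"
      by (intro filterlim_tendsto_pos_mult_at_top[OF tendsto_const]) (auto simp: filterlim_ident)
    then have evB: "eventually (\<lambda>t. norm (\<omega> (2 ^ k * t)) \<le> B * norm (\<tau> (2 ^ k * t))) at_top"
      using B(2) by (rule eventually_compose_filterlim[rotated])
    show ?thesis using A(2) evC evB eventually_ge_at_top[of 0]
    proof eventually_elim
      case (elim t)
      have pos: "0 \<le> \<tau> t" "0 \<le> \<tau> (2 ^ k * t)"
        using \<tau>(1) elim by (auto simp: weight_function_def)
      have "\<tau> (2 ^ k * t) \<le> (2 * q) ^ k * \<tau> t + C" using C elim by blast
      \<comment> \<open>The final factor 3 is 2 from \<open>q ^ k \<le> 2\<close> plus 1 from
        absorbing \<open>C\<close> into \<open>\<tau> t\<close>.\<close>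
      also have "\<dots> \<le> (2 ^ k * 2) * \<tau> t + 2 ^ k * \<tau> t"
      proof (rule add_mono)
        show "(2 * q) ^ k * \<tau> t \<le> (2 ^ k * 2) * \<tau> t"
          using \<open>q ^ k \<le> 2\<close> pos by (auto simp: power_mult_distrib intro!: mult_right_mono)
        have "1 * \<tau> t \<le> 2 ^ k * \<tau> t" using pos by (intro mult_right_mono) auto
        then show "C \<le> 2 ^ k * \<tau> t" using elim by linarith
      qed
      also have "\<dots> = 3 * 2 ^ k * \<tau> t" by simp
      also have "\<dots> \<le> 3 * 2 ^ k * (A * \<bar>\<omega> t\<bar>)"
        using elim pos by (intro mult_left_mono) auto
      finally have "B * \<tau> (2 ^ k * t) \<le> B * (3 * 2 ^ k * (A * \<bar>\<omega> t\<bar>))"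
        using B(1) by (intro mult_left_mono) auto
      then show ?case using elim pos by (simp add: mult_ac)
    qed
  qed
  then show ?thesis by blast
qed

section \<open>The sequences\<close>

text \<open>\<open>avg i\<close> will be the average slope of the convex sequence \<open>expo\<close> on \<open>{0..2 ^ i}\<close>. Distance to
  the powers of two is 1-Lipschitz and decreases with slope \<open>-1\<close> on long intervals, so \<open>avg\<close> has
  steps in \<open>[1, 2]\<close>, mean step at least \<open>3/2\<close>, and arbitrarily long runs of steps equal to \<open>1\<close>.\<close>

definition avg :: "nat \<Rightarrow> real" where
  "avg i = 3 / 2 * real i + 1 / 2 * infdist (real i) (range (\<lambda>n. 2 ^ n))"

lemma avg_Suc_ge: "avg i + 1 \<le> avg (Suc i)"
  and avg_Suc_le: "avg (Suc i) \<le> avg i + 2"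
  using infdist_triangle_abs[of "real (Suc i)" "range (\<lambda>n. 2 ^ n)" "real i"]
  by (simp_all add: avg_def dist_real_def abs_le_iff field_simps)

lemma avg_ge: "3 / 2 * real i \<le> avg i"
  by (simp add: avg_def infdist_nonneg)

lemma avg_nonneg: "0 \<le> avg i"
  by (simp add: avg_def infdist_nonneg)

lemma avg_add_ge: "avg i + real n \<le> avg (i + n)"
proof (induction n)
  case (Suc n)
  then show ?case using avg_Suc_ge[of "i + n"] by simp
qed simp

lemma avg_add_le: "avg (i + n) \<le> avg i + 2 * real n"
proof (induction n)
  case (Suc n)
  then show ?case using avg_Suc_le[of "i + n"] by simp
qed simp

lemma avg_mono: "i \<le> j \<Longrightarrow> avg i \<le> avg j"
  using avg_add_ge[of i "j - i"] by simp

lemma avg_run: "\<exists>i\<ge>m. avg (i + n) = avg i + real n"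
proof -
  \<comment> \<open>The run ends at \<open>2 ^ p\<close>. Since \<open>2 ^ p\<close> exceeds
    \<open>4 * (m + n)\<close>, no power of two is closer to its start \<open>2 ^ p - n\<close> than
    \<open>2 ^ p\<close> itself.\<close>
  define p where "p = 4 * (m + n)"
  define i where "i = 2 ^ p - n"
  have p: "4 * (m + n) < 2 ^ p" unfolding p_def by (rule less_exp)
  then have i: "i + n = 2 ^ p" "i \<ge> m" by (auto simp: i_def)
  then have ri: "real i = 2 ^ p - real n"
    by (metis add_diff_cancel_right' of_nat_add of_nat_numeral of_nat_power)
  have "4 * (real m + real n) < 2 ^ p"
    using p by (metis of_nat_add of_nat_less_iff of_nat_mult of_nat_numeral of_nat_power)
  then have pn: "4 * real n \<le> 2 ^ p" by simp
  have "infdist (real i) (range (\<lambda>n. 2 ^ n)) = real n"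
  proof (rule antisym)
    show "infdist (real i) (range (\<lambda>n. 2 ^ n)) \<le> real n"
      using infdist_le[of "2 ^ p" "range (\<lambda>n. 2 ^ n)" "real i"] by (simp add: dist_real_def ri)
    have "real n \<le> dist (real i) (2 ^ l)" for l
    proof (cases "l \<ge> p")
      case True
      then have "(2::real) ^ p \<le> 2 ^ l" by simp
      then show ?thesis unfolding dist_real_def ri by linarith
    next
      case False
      then have "(2::real) ^ Suc l \<le> 2 ^ p" by (intro power_increasing) auto
      then show ?thesis using pn unfolding dist_real_def ri power_Suc by linarith
    qed
    then show "real n \<le> infdist (real i) (range (\<lambda>n. 2 ^ n))"
      by (subst infdist_notempty) (auto intro!: cINF_greatest)
  qed
  moreover have "infdist (real (i + n)) (range (\<lambda>n. 2 ^ n)) = 0"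
    using i by (auto intro!: infdist_zero)
  ultimately have "avg (i + n) = avg i + real n" by (simp add: avg_def algebra_simps)
  then show ?thesis using i by blast
qed

text \<open>Constant on each dyadic block from \<open>2 ^ i\<close> to \<open>2 ^ Suc i\<close>: if
  the slopes below \<open>2 ^ i\<close> have mean \<open>avg i\<close>, this value raises the mean
  to \<open>avg (Suc i)\<close>.\<close>

definition slope :: "nat \<Rightarrow> real" where
  "slope k = (if k = 0 then avg 0 else 2 * avg (Suc (floor_log k)) - avg (floor_log k))"

definition expo :: "nat \<Rightarrow> real" where
  "expo j = (\<Sum>k<j. slope k)"

text \<open>Consecutive blocks are ordered as soon as twice a step of \<open>avg\<close> is at least
  the preceding step, which steps in \<open>[1, 2]\<close> guarantee.\<close>

lemma slope_mono:
  assumes "k \<le> l"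
  shows "slope k \<le> slope l"
proof -
  have *: "2 * avg (Suc i) - avg i \<le> 2 * avg (Suc j) - avg j" if "i \<le> j" for i j
  proof (rule lift_Suc_mono_le[of "\<lambda>i. 2 * avg (Suc i) - avg i", OF _ that])
    fix n
    show "2 * avg (Suc n) - avg n \<le> 2 * avg (Suc (Suc n)) - avg (Suc n)"
      using avg_Suc_ge[of "Suc n"] avg_Suc_le[of n] by linarith
  qed
  show ?thesis
  proof (cases "k = 0")
    case True
    then show ?thesis
      using *[of 0 "floor_log l"] avg_Suc_ge[of 0] by (auto simp: slope_def)
  next
    case False
    then show ?thesis
      using *[OF floor_log_le_iff[OF assms]] assms by (auto simp: slope_def)
  qed
qed

lemma slope_ge_avg:
  assumes "2 ^ i \<le> k"
  shows "avg i \<le> slope k"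
proof -
  have "k \<noteq> 0" using less_le_trans[OF _ assms, of 0] by simp
  moreover have "i \<le> floor_log k" using floor_log_le_iff[OF assms] by simp
  ultimately show ?thesis
    using avg_mono[of i "floor_log k"] avg_Suc_ge[of "floor_log k"] by (simp add: slope_def)
qed

lemma expo_power: "expo (2 ^ i) = 2 ^ i * avg i"
proof (induction i)
  case 0
  show ?case by (simp add: expo_def slope_def)
next
  case (Suc i)
  have "{..<(2::nat) ^ Suc i} = {..<2 ^ i} \<union> {2 ^ i..<2 * 2 ^ i}" by auto
  then have "expo (2 ^ Suc i) = expo (2 ^ i) + (\<Sum>k\<in>{2 ^ i..<2 * 2 ^ i}. slope k)"
    unfolding expo_def by (simp add: sum.union_disjoint ivl_disj_int)
  also have "(\<Sum>k\<in>{2 ^ i..<2 * 2 ^ i}. slope k)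
      = (\<Sum>k\<in>{(2::nat) ^ i..<2 * 2 ^ i}. 2 * avg (Suc i) - avg i)"
  proof (rule sum.cong)
    fix k :: nat assume k: "k \<in> {2 ^ i..<2 * 2 ^ i}"
    then have "k > 0" using less_le_trans[of 0 "2 ^ i" k] by simp
    then have "floor_log k = i" using k by (intro floor_log_eqI) auto
    then show "slope k = 2 * avg (Suc i) - avg i" using \<open>k > 0\<close> by (simp add: slope_def)
  qed simp
  finally show ?case using Suc by (simp add: algebra_simps)
qed

text \<open>The slopes before \<open>2 ^ i\<close> have mean exactly \<open>avg i\<close>, and all
  later ones are at least \<open>avg i\<close>.\<close>

lemma expo_ge:
  assumes "2 ^ i \<le> j"
  shows "real j * avg i \<le> expo j"
proof -
  have "{..<j} = {..<2 ^ i} \<union> {2 ^ i..<j}" using assms by auto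
  then have "expo j = expo (2 ^ i) + (\<Sum>k\<in>{2 ^ i..<j}. slope k)"
    unfolding expo_def by (simp add: sum.union_disjoint ivl_disj_int)
  also have "\<dots> \<ge> 2 ^ i * avg i + (\<Sum>k\<in>{2 ^ i..<j}. avg i)"
    unfolding expo_power by (intro add_left_mono sum_mono slope_ge_avg) auto
  also have "2 ^ i * avg i + (\<Sum>k\<in>{2 ^ i..<j}. avg i) = real j * avg i"
    using assms by (simp add: of_nat_diff algebra_simps)
  finally show ?thesis .
qed

definition seq :: "real \<Rightarrow> nat \<Rightarrow> real" where
  "seq s j = exp (s * expo j)"

lemma seq_LC:
  assumes "s > 0"
  shows "seq s \<in> LC"
proof -
  have "(seq s j)\<^sup>2 \<le> seq s (j - 1) * seq s (j + 1)" if j: "j \<ge> 1" for j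
  proof -
    obtain k where k: "j = Suc k" using j by (cases j) auto
    have "2 * expo j \<le> expo (j - 1) + expo (j + 1)"
      using slope_mono[of k "Suc k"] by (simp add: expo_def k)
    then have "s * (2 * expo j) \<le> s * (expo (j - 1) + expo (j + 1))"
      using assms by (intro mult_left_mono) auto
    then show ?thesis
      by (simp add: seq_def power2_eq_square algebra_simps flip: exp_add)
  qed
  moreover have "filterlim (\<lambda>j. root j (seq s j)) at_top sequentially"
    unfolding filterlim_at_top
  proof
    fix Z :: real
    obtain i where i: "Z / s < real i" using reals_Archimedean2 by blast
    show "eventually (\<lambda>j. Z \<le> root j (seq s j)) sequentially"
      using eventually_ge_at_top[of "2 ^ i"]
    proof eventually_elim
      case (elim j)
      then have j: "j > 0" using less_le_trans[of 0 "2 ^ i" j] by simp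
      have "Z \<le> s * real i" using i assms by (simp add: field_simps)
      also have "\<dots> \<le> s * avg i" using avg_ge[of i] assms by (intro mult_left_mono) auto
      also have "\<dots> \<le> exp (s * avg i)" using exp_ge_add_one_self[of "s * avg i"] by linarith
      also have "\<dots> = root j (exp (s * avg i) ^ j)"
        using j by (simp add: real_root_power_cancel)
      also have "exp (s * avg i) ^ j \<le> seq s j"
        using expo_ge[OF elim] assms
        by (simp add: seq_def mult_left_mono mult.left_commute flip: exp_of_nat_mult)
      then have "root j (exp (s * avg i) ^ j) \<le> root j (seq s j)" using j by simp
      finally show ?case .
    qed
  qed
  moreover have "1 \<le> seq s 1"
    using assms avg_nonneg[of 0] by (simp add: seq_def expo_def slope_def)
  ultimately show ?thesis by (auto simp: LC_def seq_def expo_def)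
qed

section \<open>Dyadic bounds for the associated weights\<close>

lemma assoc_weight_seq_ge:
  assumes "s > 0"
  shows "2 ^ i * (x - s * avg i) \<le> assoc_weight (seq s) (exp x)"
  using assoc_weight_exp_ge[OF seq_LC[OF assms], of "2 ^ i" x]
  by (simp add: seq_def expo_power algebra_simps)

text \<open>An index \<open>j\<close> in the block from \<open>2 ^ i\<close> to
  \<open>2 ^ Suc i\<close> is controlled by \<open>expo_ge\<close>, so dyadic indices determine the
  weight up to a factor 2.\<close>

lemma assoc_weight_seq_le:
  assumes "s > 0" "C \<ge> 0" and C: "\<And>i. 2 ^ Suc i * (x - s * avg i) \<le> C"
  shows "assoc_weight (seq s) (exp x) \<le> C"
proof (rule assoc_weight_exp_le[OF seq_LC[OF assms(1)]])
  fix j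
  show "real j * x - ln (seq s j) \<le> C"
  proof (cases "j = 0")
    case True
    then show ?thesis using assms by (simp add: seq_def expo_def)
  next
    case False
    define i where "i = floor_log j"
    have i: "2 ^ i \<le> j" "j < 2 ^ Suc i"
      using floor_log_exp2_le[of j] floor_log_exp2_gt[of j] False by (auto simp: i_def)
    have "s * (real j * avg i) \<le> s * expo j"
      using expo_ge[OF i(1)] assms by (intro mult_left_mono) auto
    then have "real j * x - ln (seq s j) \<le> real j * (x - s * avg i)"
      by (simp add: seq_def algebra_simps)
    also have "\<dots> \<le> C"
    proof (cases "x - s * avg i \<ge> 0")
      case True
      have "real j \<le> 2 ^ Suc i"
        using i(2) by (metis less_imp_le of_nat_le_iff of_nat_numeral of_nat_power)
      then have "real j * (x - s * avg i) \<le> 2 ^ Suc i * (x - s * avg i)"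
        using True by (rule mult_right_mono)
      then show ?thesis using C[of i] by linarith
    next
      case False
      then have "real j * (x - s * avg i) \<le> 0" by (intro mult_nonneg_nonpos) auto
      then show ?thesis using assms by linarith
    qed
    finally show ?thesis .
  qed
qed

text \<open>The summand 1 makes the \<open>i\<close>-th dyadic term exactly
  \<open>s * 2 ^ i\<close>. At these nodes the weight is thus known up to a factor 4.\<close>

lemma assoc_weight_seq_node_ge:
  assumes "s > 0"
  shows "s * 2 ^ i \<le> assoc_weight (seq s) (exp (s * (avg i + 1)))"
  using assoc_weight_seq_ge[OF assms, of i "s * (avg i + 1)"] by (simp add: algebra_simps)

lemma odd_le_double_power: "2 * real p + 1 \<le> 2 * 2 ^ p"
proof (induction p)
  case (Suc p)
  have "2 \<le> 2 * (2::real) ^ p" by simp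
  from add_mono[OF Suc this] show ?case by simp
qed simp

text \<open>Going back \<open>p\<close> indices enlarges the bracket to at most
  \<open>s * (2 * p + 1)\<close>, while the power of two shrinks by \<open>2 ^ p\<close>. Beyond
  \<open>i\<close> the bracket is not positive, as steps are at least 1.\<close>

lemma assoc_weight_seq_node_le:
  assumes "s > 0"
  shows "assoc_weight (seq s) (exp (s * (avg i + 1))) \<le> 4 * s * 2 ^ i"
proof (rule assoc_weight_seq_le)
  fix l
  show "2 ^ Suc l * (s * (avg i + 1) - s * avg l) \<le> 4 * s * 2 ^ i"
  proof (cases "l \<le> i")
    case True
    then obtain p where p: "i = l + p" using le_Suc_ex by blast
    have "avg i + 1 - avg l \<le> 2 * real p + 1"
      using avg_add_le[of l p] by (simp add: p)
    also have "\<dots> \<le> 2 * 2 ^ p" by (rule odd_le_double_power)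
    finally have "(s * 2 ^ Suc l) * (avg i + 1 - avg l) \<le> (s * 2 ^ Suc l) * (2 * 2 ^ p)"
      using assms by (intro mult_left_mono) auto
    then show ?thesis by (simp add: p power_add algebra_simps)
  next
    case False
    then have "avg (Suc i) \<le> avg l" by (intro avg_mono) auto
    then have "avg i + 1 - avg l \<le> 0" using avg_Suc_ge[of i] by linarith
    then have "(s * 2 ^ Suc l) * (avg i + 1 - avg l) \<le> 0"
      using assms by (intro mult_nonneg_nonpos) auto
    moreover have "0 \<le> 4 * s * 2 ^ i" using assms by simp
    ultimately show ?thesis by (simp add: algebra_simps)
  qed
qed (use assms in auto)

section \<open>BMT property and non-quasianalyticity\<close>

lemma assoc_weight_seq_doubling:
  assumes "s \<ge> 1 / 2"
  shows "(\<lambda>t. assoc_weight (seq s) (2 * t)) \<in> O[at_top](assoc_weight (seq s))"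
proof (rule landau_o.bigI)
  let ?\<omega> = "assoc_weight (seq s)"
  have s: "s > 0" using assms by simp
  \<comment> \<open>\<open>C\<close> serves the indices 0 and 1, which cannot be shifted down by
    two; it turns \<open>4 * (x + 1)\<close> into four times the term of index 0.\<close>
  define C where "C = 4 * (1 + s * avg 0)"
  have C: "C \<ge> 0" using s avg_nonneg[of 0] by (simp add: C_def)
  have shift: "?\<omega> (exp (x + ln 2)) \<le> 8 * ?\<omega> (exp x) + C" if x: "x \<ge> 0" for x
  proof (rule assoc_weight_seq_le[OF s])
    have nn: "0 \<le> ?\<omega> (exp x)" by (rule assoc_weight_nonneg[OF seq_LC[OF s]])
    then show "0 \<le> 8 * ?\<omega> (exp x) + C" using C by simp
    have ln2: "ln (2::real) \<le> 1" using ln2_le_25_over_36 by simp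
    fix i
    show "2 ^ Suc i * (x + ln 2 - s * avg i) \<le> 8 * ?\<omega> (exp x) + C"
    proof (cases "i \<ge> 2")
      case True
      then obtain l where l: "i = l + 2" by (metis add.commute le_Suc_ex)
      \<comment> \<open>Two steps raise \<open>s * avg\<close> by at least
        \<open>2 * s \<ge> 1 \<ge> ln 2\<close>, which absorbs the doubling of \<open>t\<close>; the
        factor 8 is \<open>2 ^ Suc i / 2 ^ l\<close>.\<close>
      have "s * (avg l + 2) \<le> s * avg i"
        using avg_add_ge[of l 2] s by (intro mult_left_mono) (auto simp: l)
      then have "x + ln 2 - s * avg i \<le> x - s * avg l"
        using assms ln2 by (simp add: algebra_simps)
      then have "2 ^ Suc i * (x + ln 2 - s * avg i) \<le> 2 ^ Suc i * (x - s * avg l)"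
        by (intro mult_left_mono) auto
      also have "\<dots> = 8 * (2 ^ l * (x - s * avg l))" by (simp add: l)
      also have "\<dots> \<le> 8 * ?\<omega> (exp x)"
        by (intro mult_left_mono assoc_weight_seq_ge[OF s]) auto
      finally show ?thesis using C by simp
    next
      case False
      have "0 \<le> s * avg i" using s avg_nonneg[of i] by simp
      then have "x + ln 2 - s * avg i \<le> x + 1" using ln2 by linarith
      then have "2 ^ Suc i * (x + ln 2 - s * avg i) \<le> 2 ^ Suc i * (x + 1)"
        by (intro mult_left_mono) auto
      also have "\<dots> \<le> 2 ^ 2 * (x + 1)"
        using False x by (intro mult_right_mono power_increasing) auto
      also have "\<dots> = 4 * (x - s * avg 0) + C" by (simp add: C_def algebra_simps)
      also have "\<dots> \<le> 4 * ?\<omega> (exp x) + C"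
        using assoc_weight_seq_ge[OF s, of 0 x] by simp
      also have "\<dots> \<le> 8 * ?\<omega> (exp x) + C" using nn by simp
      finally show ?thesis .
    qed
  qed
  have "eventually (\<lambda>t. C \<le> ?\<omega> t) at_top"
    using assoc_weight_at_top[OF seq_LC[OF s]] by (simp add: filterlim_at_top)
  then show "eventually (\<lambda>t. norm (?\<omega> (2 * t)) \<le> 9 * norm (?\<omega> t)) at_top"
    using eventually_ge_at_top[of 1]
  proof eventually_elim
    case (elim t)
    have "exp (ln t + ln 2) = 2 * t" using elim by (simp add: exp_add)
    then have "?\<omega> (2 * t) \<le> 8 * ?\<omega> t + C" using shift[of "ln t"] elim by simp
    then show ?case
      using elim assoc_weight_nonneg[OF seq_LC[OF s], of t]
        assoc_weight_nonneg[OF seq_LC[OF s], of "2 * t"] by simp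
  qed
qed simp

lemma assoc_weight_seq_BMT:
  assumes "s \<ge> 1 / 2"
  shows "BMT_weight_function (assoc_weight (seq s))"
proof -
  have "seq s \<in> LC" using assms by (intro seq_LC) simp
  then show ?thesis
    using assoc_weight_seq_doubling[OF assms]
    by (simp add: BMT_weight_function_def assoc_weight_nonneg assoc_weight_continuous
        assoc_weight_mono ln_smallo_assoc_weight assoc_weight_convex)
      (simp add: assoc_weight_def)
qed

text \<open>Here \<open>s * avg i \<ge> 3 / 4 * i\<close>, and
  \<open>ln 2 \<le> 25 / 36 < 57 / 80 = 19 / 20 * (3 / 4)\<close>, so \<open>2 ^ i\<close> is
  dominated by \<open>exp (19 / 20 * (3 / 4 * i))\<close>.\<close>

lemma assoc_weight_seq_le_powr:
  assumes "s \<ge> 1 / 2" "t \<ge> 1"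
  shows "assoc_weight (seq s) t \<le> 4 * t powr (19 / 20)"
proof -
  define x where "x = ln t"
  have t: "t = exp x" "t powr (19 / 20) = exp (19 / 20 * x)"
    using assms by (auto simp: x_def powr_def)
  show ?thesis unfolding t(2) unfolding t(1)
  proof (rule assoc_weight_seq_le)
    fix i
    define y where "y = x - 3 / 4 * real i"
    have "1 / 2 * (3 / 2 * real i) \<le> s * avg i"
      using assms avg_ge[of i] by (intro mult_mono) auto
    then have "2 ^ Suc i * (x - s * avg i) \<le> 2 ^ Suc i * y"
      by (intro mult_left_mono) (auto simp: y_def)
    also have "\<dots> \<le> 2 ^ Suc i * (2 * exp (19 / 20 * y))"
    proof (intro mult_left_mono)
      show "y \<le> 2 * exp (19 / 20 * y)"
        using exp_ge_add_one_self[of "19 / 20 * y"] exp_gt_zero[of "19 / 20 * y"] by linarith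
    qed simp
    also have "\<dots> = 4 * (2 ^ i * exp (19 / 20 * y))" by simp
    also have "(2::real) ^ i = exp (real i * ln 2)" by (simp add: exp_of_nat_mult)
    also have "exp (real i * ln 2) * exp (19 / 20 * y) = exp (real i * ln 2 + 19 / 20 * y)"
      by (simp add: exp_add)
    also have "real i * ln 2 + 19 / 20 * y \<le> 19 / 20 * x"
    proof -
      have "real i * ln 2 \<le> real i * (57 / 80)"
        using ln2_le_25_over_36 by (intro mult_left_mono) auto
      then have "real i * ln 2 + 19 / 20 * y \<le> real i * (57 / 80) + 19 / 20 * y"
        by (rule add_right_mono)
      also have "\<dots> = 19 / 20 * x" by (simp add: y_def field_simps)
      finally show ?thesis .
    qed
    finally show "2 ^ Suc i * (x - s * avg i) \<le> 4 * exp (19 / 20 * x)" by simp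
  qed (use assms in auto)
qed

lemma assoc_weight_seq_non_quasianalytic:
  assumes "s \<ge> 1 / 2"
  shows "non_quasianalytic (assoc_weight (seq s))"
  unfolding non_quasianalytic_def set_integrable_def
proof (rule Bochner_Integration.integrable_bound[OF _ _ AE_I2])
  let ?\<omega> = "assoc_weight (seq s)"
  have LC: "seq s \<in> LC" using assms by (intro seq_LC) simp
  have "(\<lambda>t::real. t powr (- (21 / 20))) integrable_on {1..}"
    using has_integral_powr_to_inf[of "- (21 / 20)" 1] unfolding integrable_on_def by auto
  then have "(\<lambda>t::real. t powr (- (21 / 20))) absolutely_integrable_on {1..}"
    by (subst absolutely_integrable_on_iff_nonneg) auto
  from integrable_mult_right[OF this[unfolded set_integrable_def], of 4]
  show "integrable lborel (\<lambda>t::real. indicat_real {1..} t *\<^sub>R (4 * t powr (- (21 / 20))))"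
    \<comment> \<open>Absolute integrability refers to the completed measure, so the majorant is
      carried back to \<open>lborel\<close>.\<close>
    by (subst (asm) integrable_completion) (auto simp: mult_ac)
  have "continuous_on {1..} (\<lambda>t. ?\<omega> t / t\<^sup>2)"
    by (intro continuous_intros continuous_on_subset[OF assoc_weight_continuous[OF LC]]) auto
  then have "set_borel_measurable borel {1..} (\<lambda>t. ?\<omega> t / t\<^sup>2)"
    by (intro borel_measurable_continuous_on_indicator[folded set_borel_measurable_def]) auto
  then show "(\<lambda>t. indicat_real {1..} t *\<^sub>R (?\<omega> t / t\<^sup>2)) \<in> borel_measurable lborel"
    by (simp add: set_borel_measurable_def)
  fix t :: real
  have "?\<omega> t / t\<^sup>2 \<le> 4 * t powr (- (21 / 20))" if "t \<ge> 1"
  proof -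
    have "t powr (19 / 20) = t powr (- (21 / 20)) * t\<^sup>2"
      using that by (simp flip: powr_numeral powr_add)
    then show ?thesis
      using assoc_weight_seq_le_powr[OF assms that] that by (simp add: field_simps)
  qed
  then show "norm (indicat_real {1..} t *\<^sub>R (?\<omega> t / t\<^sup>2))
      \<le> norm (indicat_real {1..} t *\<^sub>R (4 * t powr (- (21 / 20))))"
    using assoc_weight_nonneg[OF LC, of t] by (auto simp: indicator_def)
qed

section \<open>Non-equivalence\<close>

text \<open>At node \<open>i\<close> for \<open>s\<close> the weight for \<open>s'\<close> lags by
  any prescribed number \<open>p\<close> of nodes: the gap \<open>(s' - s) * avg i\<close> is
  unbounded, while \<open>p\<close> nodes span at most \<open>2 * p * s'\<close>.\<close>

lemma assoc_weight_seq_not_bigo: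
  assumes "0 < s" "s < s'"
  shows "assoc_weight (seq s) \<notin> O[at_top](assoc_weight (seq s'))"
proof
  have s': "s' > 0" using assms by simp
  note LC = seq_LC[OF assms(1)] seq_LC[OF s']
  assume "assoc_weight (seq s) \<in> O[at_top](assoc_weight (seq s'))"
  then obtain c where c: "c > 0"
    "eventually (\<lambda>t. norm (assoc_weight (seq s) t) \<le> c * norm (assoc_weight (seq s') t)) at_top"
    by (rule landau_o.bigE)
  then obtain T where
    "\<And>t. t \<ge> T \<Longrightarrow> norm (assoc_weight (seq s) t) \<le> c * norm (assoc_weight (seq s') t)"
    by (auto simp: eventually_at_top_linorder)
  then have T: "assoc_weight (seq s) t \<le> c * assoc_weight (seq s') t" if "t \<ge> T" for t
    using that assoc_weight_nonneg[OF LC(1)] assoc_weight_nonneg[OF LC(2)] by simp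
  obtain p where p: "4 * c * s' / s < 2 ^ p" using real_arch_pow[of 2] by fastforce
  \<comment> \<open>The three demands make \<open>i - p\<close> a true difference, put the node
    beyond \<open>T\<close>, and create the lag of \<open>p\<close> nodes.\<close>
  obtain i where i: "i \<ge> p" "T / s \<le> real i" "(2 * real p + 1) * s' / (s' - s) \<le> real i"
  proof -
    obtain k where "max (T / s) ((2 * real p + 1) * s' / (s' - s)) < real k"
      using reals_Archimedean2 by blast
    then show ?thesis by (intro that[of "max p k"]) auto
  qed
  have ai: "real i \<le> avg i" using avg_ge[of i] by simp
  define x where "x = s * (avg i + 1)"
  define l where "l = i - p"
  have l: "i = l + p" using i by (simp add: l_def)
  have "T \<le> s * real i" using i assms by (simp add: field_simps)
  also have "\<dots> \<le> x" using ai assms by (simp add: x_def)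
  also have "\<dots> \<le> exp x" using exp_ge_add_one_self[of x] by linarith
  finally have Tx: "T \<le> exp x" .
  have "(2 * real p + 1) * s' \<le> real i * (s' - s)" using i assms by (simp add: field_simps)
  also have "\<dots> \<le> avg i * (s' - s)" using ai assms by (intro mult_right_mono) auto
  finally have "x \<le> s' * (avg i - 2 * real p)" using assms by (simp add: x_def algebra_simps)
  also have "\<dots> \<le> s' * (avg l + 1)"
    using avg_add_le[of l p] s' by (intro mult_left_mono) (auto simp: l)
  finally have xl: "x \<le> s' * (avg l + 1)" .
  have "s * 2 ^ i \<le> assoc_weight (seq s) (exp x)"
    using assoc_weight_seq_node_ge[OF assms(1)] by (simp add: x_def)
  also have "\<dots> \<le> c * assoc_weight (seq s') (exp x)" using T[OF Tx] .
  also have "\<dots> \<le> c * assoc_weight (seq s') (exp (s' * (avg l + 1)))"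
    using c xl by (intro mult_left_mono mono_onD[OF assoc_weight_mono[OF LC(2)]]) auto
  also have "\<dots> \<le> c * (4 * s' * 2 ^ l)"
    using c by (intro mult_left_mono assoc_weight_seq_node_le[OF s']) auto
  finally have "s * 2 ^ p \<le> 4 * c * s'" by (simp add: l power_add mult_ac)
  then show False using p assms by (simp add: field_simps)
qed

text \<open>On a run of \<open>10 * N\<close> steps of length \<open>s\<close> the weight grows by a factor comparable to
  \<open>2 ^ (10 * N)\<close>, while \<open>t\<close> grows by at most \<open>2 ^ (9 * N)\<close>, because \<open>10 * s \<le> 6 \<le> 9 * ln 2\<close>.\<close>

lemma assoc_weight_seq_not_almost_subadditive:
  assumes s: "0 < s" "s \<le> 3 / 5"
    and \<tau>: "weight_function \<tau>" "almost_subadditive \<tau>"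
      "equivalent_functions \<tau> (assoc_weight (seq s))"
  shows False
proof -
  let ?\<omega> = "assoc_weight (seq s)"
  note LC = seq_LC[OF s(1)]
  obtain D where D: "\<And>k. eventually (\<lambda>t. ?\<omega> (2 ^ k * t) \<le> D * 2 ^ k * \<bar>?\<omega> t\<bar>) at_top"
    using equivalent_almost_subadditive_dyadic[OF \<tau>] by blast
  \<comment> \<open>The 4 is the loss between the two node bounds; \<open>2 ^ N\<close> is the
    surplus of \<open>2 ^ (10 * N)\<close> over \<open>2 ^ (9 * N)\<close>.\<close>
  obtain N where N: "4 * \<bar>D\<bar> < 2 ^ N" using real_arch_pow[of 2] by fastforce
  obtain T where T: "\<And>t. t \<ge> T \<Longrightarrow> ?\<omega> (2 ^ (9 * N) * t) \<le> D * 2 ^ (9 * N) * \<bar>?\<omega> t\<bar>"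
    using D[of "9 * N"] by (auto simp: eventually_at_top_linorder)
  obtain m where m: "T / s < real m" using reals_Archimedean2 by blast
  obtain i where i: "i \<ge> m" "avg (i + 10 * N) = avg i + real (10 * N)" using avg_run by blast
  define x where "x = s * (avg i + 1)"
  have "T \<le> s * real m" using m s by (simp add: field_simps)
  also have "\<dots> \<le> s * real i" using i s by simp
  also have "\<dots> \<le> x" using avg_ge[of i] s by (simp add: x_def)
  also have "\<dots> \<le> exp x" using exp_ge_add_one_self[of x] by linarith
  finally have Tx: "T \<le> exp x" .
  have "s * real (10 * N) \<le> 3 / 5 * real (10 * N)" using s by (intro mult_right_mono) auto
  also have "\<dots> = real (9 * N) * (2 / 3)" by simp
  also have "\<dots> \<le> real (9 * N) * ln 2"
    using ln2_ge_two_thirds by (intro mult_left_mono) auto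
  finally have "s * real (10 * N) + x \<le> real (9 * N) * ln 2 + x" by (rule add_right_mono)
  also have "s * real (10 * N) + x = s * (avg (i + 10 * N) + 1)"
    unfolding i x_def by (simp add: algebra_simps)
  finally have step: "s * (avg (i + 10 * N) + 1) \<le> real (9 * N) * ln 2 + x" .
  have "s * 2 ^ (i + 10 * N) \<le> ?\<omega> (exp (s * (avg (i + 10 * N) + 1)))"
    by (rule assoc_weight_seq_node_ge[OF s(1)])
  also have "\<dots> \<le> ?\<omega> (exp (real (9 * N) * ln 2 + x))"
    using step by (intro mono_onD[OF assoc_weight_mono[OF LC]]) auto
  also have "exp (real (9 * N) * ln 2 + x) = 2 ^ (9 * N) * exp x"
    unfolding exp_add exp_of_nat_mult by simp
  also have "?\<omega> \<dots> \<le> D * 2 ^ (9 * N) * \<bar>?\<omega> (exp x)\<bar>" by (rule T[OF Tx])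
  also have "\<dots> \<le> \<bar>D\<bar> * 2 ^ (9 * N) * (4 * s * 2 ^ i)"
    using assoc_weight_seq_node_le[OF s(1), of i] assoc_weight_nonneg[OF LC]
    by (intro mult_mono) (auto simp: x_def)
  also have "i + 10 * N = i + 9 * N + N" by simp
  finally have "(s * 2 ^ i * 2 ^ (9 * N)) * 2 ^ N \<le> (s * 2 ^ i * 2 ^ (9 * N)) * (4 * \<bar>D\<bar>)"
    by (simp only: power_add mult_ac)
  then show False using N s by simp
qed

text \<open>At \<open>j = 2 ^ i\<close> the root is exactly \<open>exp ((s - s') * avg i)\<close>,
  which tends to 0 or to infinity according to the sign of \<open>s - s'\<close>.\<close>

lemma seq_not_equivalent:
  assumes "s \<noteq> s'"
  shows "\<not> equivalent_sequences (seq s) (seq s')"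
proof
  assume "equivalent_sequences (seq s) (seq s')"
  then have lo: "0 < (INF j\<in>{1..}. ereal (root j (seq s j / seq s' j)))"
    and hi: "(SUP j\<in>{1..}. ereal (root j (seq s j / seq s' j))) < \<infinity>"
    by (auto simp: equivalent_sequences_def)
  have root: "root (2 ^ i) (seq s (2 ^ i) / seq s' (2 ^ i)) = exp ((s - s') * avg i)" for i
  proof -
    have "seq s (2 ^ i) / seq s' (2 ^ i) = exp ((s - s') * avg i) ^ (2 ^ i)"
      by (simp add: seq_def expo_power algebra_simps flip: exp_diff exp_of_nat_mult)
    then show ?thesis by (simp add: real_root_power_cancel)
  qed
  have growth: "d * real i < exp (d * avg i)" if "d > 0" for d i
  proof -
    have "d * real i \<le> d * avg i" using avg_ge[of i] that by (intro mult_left_mono) auto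
    then show ?thesis using exp_ge_add_one_self[of "d * avg i"] by linarith
  qed
  show False
  proof (cases "s < s'")
    case True
    obtain e where e: "0 < e" "ereal e < (INF j\<in>{1..}. ereal (root j (seq s j / seq s' j)))"
      using ereal_dense2[OF lo] by auto
    obtain i where i: "1 / (e * (s' - s)) < real i" using reals_Archimedean2 by blast
    have "(INF j\<in>{1..}. ereal (root j (seq s j / seq s' j)))
        \<le> ereal (root (2 ^ i) (seq s (2 ^ i) / seq s' (2 ^ i)))"
      by (intro INF_lower) auto
    then have "e < exp ((s - s') * avg i)"
      using e unfolding root by (metis ereal_less_eq(3) less_le_trans less_ereal.simps(1))
    also have "(s - s') * avg i = - ((s' - s) * avg i)" by (simp add: algebra_simps)
    also have "exp \<dots> = 1 / exp ((s' - s) * avg i)" by (simp only: exp_minus inverse_eq_divide)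
    finally have "e * exp ((s' - s) * avg i) < 1" by (simp add: field_simps)
    moreover have "e * ((s' - s) * real i) < e * exp ((s' - s) * avg i)"
      using growth[of "s' - s" i] True e by (intro mult_strict_left_mono) auto
    moreover have "1 < e * ((s' - s) * real i)" using i e True by (simp add: field_simps)
    ultimately show False by linarith
  next
    case False
    then have d: "s - s' > 0" using assms by simp
    obtain n where n: "(SUP j\<in>{1..}. ereal (root j (seq s j / seq s' j))) < ereal (real n)"
      using hi less_PInf_Ex_of_nat by auto
    obtain i where i: "real n / (s - s') < real i" using reals_Archimedean2 by blast
    have "ereal (root (2 ^ i) (seq s (2 ^ i) / seq s' (2 ^ i)))
        \<le> (SUP j\<in>{1..}. ereal (root j (seq s j / seq s' j)))"
      by (intro SUP_upper) auto
    then have "exp ((s - s') * avg i) < real n"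
      using n unfolding root by (metis le_less_trans less_ereal.simps(1))
    moreover have "real n < (s - s') * real i" using i d by (simp add: field_simps)
    ultimately show False using growth[OF d, of i] by linarith
  qed
qed

section \<open>The uncountable family\<close>

lemma inj_seq: "inj seq"
proof
  fix s s' assume "seq s = seq s'"
  then have "seq s (2 ^ 1) = seq s' (2 ^ 1)" by simp
  then have "s * expo (2 ^ 1) = s' * expo (2 ^ 1)" by (simp add: seq_def)
  moreover have "expo (2 ^ 1) > 0" using avg_ge[of 1] unfolding expo_power by simp
  ultimately show "s = s'" by simp
qed

theorem theorem3p6:
  shows "\<exists>F :: (nat \<Rightarrow> real) set.
    F \<subseteq> LC \<and> uncountable F \<and>
    pairwise (\<lambda>M N. \<not> equivalent_sequences M N) F \<and>
    pairwise (\<lambda>M N. \<not> equivalent_functions (assoc_weight M) (assoc_weight N)) F \<and>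
    (\<forall>M\<in>F. BMT_weight_function (assoc_weight M) \<and>
            normalized_weight (assoc_weight M) \<and>
            non_quasianalytic (assoc_weight M)) \<and>
    (\<forall>M\<in>F. \<not> (\<exists>\<tau>. weight_function \<tau> \<and>
                   equivalent_functions \<tau> (assoc_weight M) \<and>
                   almost_subadditive \<tau>))"
proof (rule exI[of _ "seq ` {1 / 2..3 / 5}"], intro conjI)
  \<comment> \<open>The bound \<open>1 / 2\<close> serves doubling and integrability, the bound
    \<open>3 / 5\<close> the failure of almost subadditivity.\<close>
  show "seq ` {1 / 2..3 / 5} \<subseteq> LC" by (auto intro!: seq_LC)
  show "uncountable (seq ` {1 / 2..3 / 5})"
    using countable_image_inj_on[of seq "{1 / 2..3 / 5}"] inj_on_subset[OF inj_seq]
      uncountable_closed_interval[of "1 / 2" "3 / 5"] by auto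
  show "pairwise (\<lambda>M N. \<not> equivalent_sequences M N) (seq ` {1 / 2..3 / 5})"
    by (auto simp: pairwise_def) (metis seq_not_equivalent)
  show "pairwise (\<lambda>M N. \<not> equivalent_functions (assoc_weight M) (assoc_weight N))
      (seq ` {1 / 2..3 / 5})"
  proof (clarsimp simp: pairwise_def)
    fix s s' :: real
    assume "1 \<le> s * 2" "s * 5 \<le> 3" "1 \<le> s' * 2" "s' * 5 \<le> 3" "seq s \<noteq> seq s'"
      and "equivalent_functions (assoc_weight (seq s)) (assoc_weight (seq s'))"
    then show False
      using assoc_weight_seq_not_bigo[of s s'] assoc_weight_seq_not_bigo[of s' s]
      by (cases s s' rule: linorder_cases) (auto simp: equivalent_functions_def)
  qed
  show "\<forall>M\<in>seq ` {1 / 2..3 / 5}. BMT_weight_function (assoc_weight M) \<and>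
      normalized_weight (assoc_weight M) \<and> non_quasianalytic (assoc_weight M)"
    by (auto intro!: assoc_weight_seq_BMT assoc_weight_normalized seq_LC
        assoc_weight_seq_non_quasianalytic)
  show "\<forall>M\<in>seq ` {1 / 2..3 / 5}. \<not> (\<exists>\<tau>. weight_function \<tau> \<and>
      equivalent_functions \<tau> (assoc_weight M) \<and> almost_subadditive \<tau>)"
    using assoc_weight_seq_not_almost_subadditive by force
qed

end
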